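(* Let $(A,d)$ be a differential graded algebra. If the graded ring $\ker(d)$ has finite gr-uniform dimension, then $(A,d)$ has finite dg-uniform dimension.
   Context: A differential graded algebra $(A,d)$ is an associative unital $\mathbb Z$-graded algebra with an endomorphism $d$ of degree $1$, $d^2=0$, $d(ab)=d(a)b+(-1)^{|a|}a\,d(b)$ for $a$ homogeneous; $\ker(d)$ is a graded subalgebra. A dg-right ideal is a graded right ideal stable under $d$. A graded ring has finite gr-uniform dimension if, as a right module over itself, it contains no infinite direct sum of non-zero graded submodules (graded right ideals). $(A,d)$ has finite dg-uniform dimension if, as a right dg-module over itself, it contains no infinite direct sum of non-zero dg-submodules (dg-right ideals). *)

theory Defs
  imports "HOL-Algebra.Algebra"
begin

definition sum_of_family :: "('a, 'm) ring_scheme \<Rightarrow> 'i set \<Rightarrow> ('i \<Rightarrow> 'a set) \<Rightarrow> 'a set" where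
  "sum_of_family R J N =
     {finsum R f F | f F. finite F \<and> F \<subseteq> J \<and> f \<in> (\<Pi> i\<in>F. N i)}"

text \<open>The sum of a (possibly infinite) family of additive subgroups is direct iff every finite
  sum that vanishes has only zero summands.\<close>

definition direct_family :: "('a, 'm) ring_scheme \<Rightarrow> 'i set \<Rightarrow> ('i \<Rightarrow> 'a set) \<Rightarrow> bool" where
  "direct_family R J N \<longleftrightarrow>
     (\<forall>F f. finite F \<longrightarrow> F \<subseteq> J \<longrightarrow> f \<in> (\<Pi> i\<in>F. N i) \<longrightarrow> finsum R f F = \<zero>\<^bsub>R\<^esub> \<longrightarrow>
        (\<forall>i\<in>F. f i = \<zero>\<^bsub>R\<^esub>))"

locale graded_ring = ring R for R (structure) +
  fixes G :: "int \<Rightarrow> 'a set"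
  assumes component_subgroup: "additive_subgroup (G i) R"
    and one_degree_zero: "\<one> \<in> G 0"
    and component_mult: "\<lbrakk>a \<in> G i; b \<in> G j\<rbrakk> \<Longrightarrow> a \<otimes> b \<in> G (i + j)"
    and components_span: "carrier R = sum_of_family R UNIV G"
    and components_direct: "direct_family R UNIV G"

text \<open>The locale \<open>algebra\<close> of the library forces the multiplication to be commutative,
  so the (associative, unital) algebra structure over the commutative ring \<open>K\<close> is spelled out.
  The differential is an endomorphism of \<open>K\<close>-modules.\<close>

locale dg_algebra = graded_ring A G + K: module K A
  for K :: "('k, 'n) ring_scheme" and A :: "('k, 'a, 'm) module_scheme" (structure)
    and G :: "int \<Rightarrow> 'a set" +
  fixes d :: "'a \<Rightarrow> 'a"
  assumes smult_mult_left:
      "\<lbrakk>k \<in> carrier K; a \<in> carrier A; b \<in> carrier A\<rbrakk> \<Longrightarrow> (k \<odot> a) \<otimes> b = k \<odot> (a \<otimes> b)"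
    and smult_mult_right:
      "\<lbrakk>k \<in> carrier K; a \<in> carrier A; b \<in> carrier A\<rbrakk> \<Longrightarrow> a \<otimes> (k \<odot> b) = k \<odot> (a \<otimes> b)"
    and component_submodule: "submodule (G i) K A"
    and d_hom: "abelian_group_hom A A d"
    and d_smult: "\<lbrakk>k \<in> carrier K; a \<in> carrier A\<rbrakk> \<Longrightarrow> d (k \<odot> a) = k \<odot> d a"
    and d_degree: "a \<in> G i \<Longrightarrow> d a \<in> G (i + 1)"
    and d_square: "a \<in> carrier A \<Longrightarrow> d (d a) = \<zero>"
    and leibniz:
      "\<lbrakk>a \<in> G i; b \<in> carrier A\<rbrakk> \<Longrightarrow>
         d (a \<otimes> b) = d a \<otimes> b \<oplus> (if even i then a \<otimes> d b else \<ominus> (a \<otimes> d b))"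

definition right_ideal :: "('a, 'm) ring_scheme \<Rightarrow> 'a set \<Rightarrow> bool" where
  "right_ideal R I \<longleftrightarrow>
     additive_subgroup I R \<and> (\<forall>x\<in>I. \<forall>r\<in>carrier R. x \<otimes>\<^bsub>R\<^esub> r \<in> I)"

text \<open>Only the inclusion of \<open>I\<close> in the sum of its homogeneous parts has content; that sum
  is direct because the sum of the \<open>G i\<close> is.\<close>

definition graded_right_ideal ::
  "('a, 'm) ring_scheme \<Rightarrow> (int \<Rightarrow> 'a set) \<Rightarrow> 'a set \<Rightarrow> bool" where
  "graded_right_ideal R G I \<longleftrightarrow>
     right_ideal R I \<and> I = sum_of_family R UNIV (\<lambda>i. I \<inter> G i)"

definition dg_right_ideal ::
  "('a, 'm) ring_scheme \<Rightarrow> (int \<Rightarrow> 'a set) \<Rightarrow> ('a \<Rightarrow> 'a) \<Rightarrow> 'a set \<Rightarrow> bool" where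
  "dg_right_ideal A G d I \<longleftrightarrow> graded_right_ideal A G I \<and> d ` I \<subseteq> I"

text \<open>Members of a family of non-zero subgroups with direct sum are pairwise distinct, so
  infinite direct sums over arbitrary index sets are the same as direct sums over infinite
  sets of subgroups, each indexed by itself.\<close>

definition finite_gr_uniform_dim :: "('a, 'm) ring_scheme \<Rightarrow> (int \<Rightarrow> 'a set) \<Rightarrow> bool" where
  "finite_gr_uniform_dim R G \<longleftrightarrow>
     \<not> (\<exists>S. infinite S \<and> (\<forall>I\<in>S. graded_right_ideal R G I \<and> I \<noteq> {\<zero>\<^bsub>R\<^esub>}) \<and>
          direct_family R S (\<lambda>I. I))"

definition finite_dg_uniform_dim ::
  "('a, 'm) ring_scheme \<Rightarrow> (int \<Rightarrow> 'a set) \<Rightarrow> ('a \<Rightarrow> 'a) \<Rightarrow> bool" where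
  "finite_dg_uniform_dim A G d \<longleftrightarrow>
     \<not> (\<exists>S. infinite S \<and> (\<forall>I\<in>S. dg_right_ideal A G d I \<and> I \<noteq> {\<zero>\<^bsub>A\<^esub>}) \<and>
          direct_family A S (\<lambda>I. I))"

definition ker_ring :: "('a, 'm) ring_scheme \<Rightarrow> ('a \<Rightarrow> 'a) \<Rightarrow> ('a, 'm) ring_scheme" where
  "ker_ring A d = A\<lparr>carrier := a_kernel A A d\<rparr>"

definition ker_grading ::
  "('a, 'm) ring_scheme \<Rightarrow> (int \<Rightarrow> 'a set) \<Rightarrow> ('a \<Rightarrow> 'a) \<Rightarrow> int \<Rightarrow> 'a set" where
  "ker_grading A G d i = G i \<inter> a_kernel A A d"

lemma finsum_carrier_update:
  assumes "abelian_group R" "additive_subgroup H R" "abelian_group (R\<lparr>carrier := H\<rparr>)"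
    and "finite F" "f \<in> F \<rightarrow> H"
  shows "finsum (R\<lparr>carrier := H\<rparr>) f F = finsum R f F"
proof -
  interpret R: abelian_group R by fact
  interpret H: additive_subgroup H R by fact
  interpret S: abelian_group "R\<lparr>carrier := H\<rparr>" by fact
  show ?thesis
    using assms(4,5)
  proof (induction F rule: finite_induct)
    case empty
    show ?case by simp
  next
    case (insert x F)
    then have "f \<in> F \<rightarrow> carrier R" "f x \<in> carrier R" "f x \<in> H" "f \<in> F \<rightarrow> H"
      using H.a_subset by auto
    then show ?case using insert by (simp add: Pi_iff)
  qed
qed

context dg_algebra
begin

interpretation d: abelian_group_hom A A d by (rule d_hom)

lemma component_carrier: "a \<in> G i \<Longrightarrow> a \<in> carrier A"
  using component_subgroup additive_subgroup.a_subset by blast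

lemma d_one: "d \<one> = \<zero>"
proof -
  have "d (\<one> \<otimes> \<one>) = d \<one> \<otimes> \<one> \<oplus> \<one> \<otimes> d \<one>"
    using leibniz[OF one_degree_zero, of \<one>] by simp
  then have "d \<one> \<oplus> d \<one> = d \<one>" by (metis d.hom_closed l_one one_closed r_one)
  then show ?thesis using d.hom_closed[OF one_closed] by (metis add.r_cancel_one)
qed

lemma d_finsum:
  "finite F \<Longrightarrow> f \<in> F \<rightarrow> carrier A \<Longrightarrow> d (finsum A f F) = finsum A (\<lambda>i. d (f i)) F"
proof (induction F rule: finite_induct)
  case (insert x F)
  then have "f \<in> F \<rightarrow> carrier A" "f x \<in> carrier A" "(\<lambda>i. d (f i)) \<in> F \<rightarrow> carrier A" "d (f x) \<in> carrier A"
    using d.hom_closed by (auto simp: Pi_iff)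
  then show ?case using insert by simp
qed simp

lemma homogeneous_parts_in_kernel:
  assumes "finite F" "f \<in> (\<Pi> i\<in>F. G i)" "d (finsum A f F) = \<zero>" "i \<in> F"
  shows "d (f i) = \<zero>"
proof -
  have fc: "f \<in> F \<rightarrow> carrier A" using assms(2) component_carrier by blast
  define g where "g = (\<lambda>j. d (f (j - 1)))"
  have "finsum A g ((\<lambda>i. i + 1) ` F) = finsum A (\<lambda>i. g (i + 1)) F"
    using fc by (intro finsum_reindex) (auto simp: g_def inj_on_def Pi_iff)
  also have "\<dots> = \<zero>" using d_finsum[OF assms(1) fc] assms(3) by (simp add: g_def)
  finally have "finsum A g ((\<lambda>i. i + 1) ` F) = \<zero>" .
  moreover have "g \<in> (\<Pi> j\<in>(\<lambda>i. i + 1) ` F. G j)"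
    using assms(2) d_degree by (auto simp: g_def Pi_iff)
  ultimately have "\<forall>j\<in>(\<lambda>i. i + 1) ` F. g j = \<zero>"
    using components_direct assms(1) unfolding direct_family_def by blast
  then show ?thesis using assms(4) by (auto simp: g_def)
qed

lemma d_mult_kernel:
  assumes a: "a \<in> carrier A" "d a = \<zero>" and b: "b \<in> carrier A" "d b = \<zero>"
  shows "d (a \<otimes> b) = \<zero>"
proof -
  from a(1) obtain f F where F: "finite F" "f \<in> (\<Pi> i\<in>F. G i)" "a = finsum A f F"
    using components_span unfolding sum_of_family_def by auto
  have fc: "f \<in> F \<rightarrow> carrier A" using F(2) component_carrier by blast
  have "d (f i \<otimes> b) = \<zero>" if "i \<in> F" for i
  proof -
    have "f i \<in> G i" "f i \<in> carrier A" using that F(2) fc by auto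
    then show ?thesis
      using leibniz[of "f i" i b] homogeneous_parts_in_kernel[OF F(1,2) _ that] F(3) a b by simp
  qed
  then have "finsum A (\<lambda>i. d (f i \<otimes> b)) F = finsum A (\<lambda>i. \<zero>) F"
    by (intro finsum_cong') auto
  moreover have "a \<otimes> b = finsum A (\<lambda>i. f i \<otimes> b) F"
    using finsum_ldistr[OF F(1) b(1) fc] F(3) by simp
  moreover have "(\<lambda>i. f i \<otimes> b) \<in> F \<rightarrow> carrier A" using fc b by auto
  ultimately show ?thesis using d_finsum[OF F(1)] by simp
qed

lemma kernel_iff: "a \<in> a_kernel A A d \<longleftrightarrow> a \<in> carrier A \<and> d a = \<zero>"
  unfolding a_kernel_def' by (rule mem_Collect_eq)

lemma kernel_subring: "subring (a_kernel A A d) A"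
proof (rule subringI)
  fix x y assume "x \<in> a_kernel A A d" "y \<in> a_kernel A A d"
  then show "x \<oplus> y \<in> a_kernel A A d" by (simp add: kernel_iff)
qed (auto simp: kernel_iff d_one d_mult_kernel)

theorem ker_graded_ring: "graded_ring (ker_ring A d) (ker_grading A G d)"
proof -
  let ?Z = "a_kernel A A d"
  have Z: "additive_subgroup ?Z A" by (rule d.additive_subgroup_a_kernel)
  have r: "ring (ker_ring A d)" unfolding ker_ring_def by (rule subring_is_ring[OF kernel_subring])
  have fs: "finsum (ker_ring A d) f F = finsum A f F" if "finite F" "f \<in> F \<rightarrow> ?Z"
    for f :: "int \<Rightarrow> 'a" and F
    using finsum_carrier_update[OF abelian_group_axioms Z _ that] ring.is_abelian_group[OF r]
    by (simp add: ker_ring_def)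
  show ?thesis
  proof (intro graded_ring.intro graded_ring_axioms.intro r)
    fix i
    show "additive_subgroup (ker_grading A G d i) (ker_ring A d)"
    proof (rule additive_subgroup.intro)
      have "subgroup (G i \<inter> ?Z) (add_monoid A)"
        using component_subgroup[of i] Z add.subgroups_Inter_pair
        by (simp add: additive_subgroup_def)
      then show "subgroup (ker_grading A G d i) (add_monoid (ker_ring A d))"
        using add.subgroup_incl[of "G i \<inter> ?Z" ?Z] Z
        by (simp add: additive_subgroup_def ker_grading_def ker_ring_def)
    qed
  next
    show "\<one>\<^bsub>ker_ring A d\<^esub> \<in> ker_grading A G d 0"
      using one_degree_zero by (simp add: ker_ring_def ker_grading_def kernel_iff d_one)
  next
    fix a i b j assume "a \<in> ker_grading A G d i" "b \<in> ker_grading A G d j"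
    then show "a \<otimes>\<^bsub>ker_ring A d\<^esub> b \<in> ker_grading A G d (i + j)"
      by (auto simp: ker_ring_def ker_grading_def kernel_iff component_mult d_mult_kernel)
  next
    show "carrier (ker_ring A d) = sum_of_family (ker_ring A d) UNIV (ker_grading A G d)"
    proof (intro equalityI subsetI)
      fix x assume "x \<in> carrier (ker_ring A d)"
      then have x: "x \<in> carrier A" "d x = \<zero>" by (auto simp: ker_ring_def kernel_iff)
      from x(1) obtain f F where F: "finite F" "f \<in> (\<Pi> i\<in>F. G i)" "x = finsum A f F"
        using components_span unfolding sum_of_family_def by auto
      have "f i \<in> ker_grading A G d i" if "i \<in> F" for i
        using homogeneous_parts_in_kernel[OF F(1,2) _ that] F x that component_carrier
        by (auto simp: ker_grading_def kernel_iff)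
      moreover from this have "finsum (ker_ring A d) f F = x"
        using fs[OF F(1)] F(3) by (auto simp: ker_grading_def)
      ultimately show "x \<in> sum_of_family (ker_ring A d) UNIV (ker_grading A G d)"
        using F(1) unfolding sum_of_family_def by blast
    next
      fix x assume "x \<in> sum_of_family (ker_ring A d) UNIV (ker_grading A G d)"
      then obtain f F where F: "finite F" "f \<in> (\<Pi> i\<in>F. ker_grading A G d i)"
          "x = finsum (ker_ring A d) f F"
        unfolding sum_of_family_def by auto
      interpret Z: ring "ker_ring A d" by (rule r)
      show "x \<in> carrier (ker_ring A d)"
        unfolding F(3) using F(2)
        by (intro Z.finsum_closed) (auto simp: ker_grading_def ker_ring_def)
    qed
  next
    show "direct_family (ker_ring A d) UNIV (ker_grading A G d)"
      unfolding direct_family_def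
    proof (intro allI impI)
      fix F f
      assume F: "finite F" "f \<in> (\<Pi> i\<in>F. ker_grading A G d i)"
        "finsum (ker_ring A d) f F = \<zero>\<^bsub>ker_ring A d\<^esub>"
      have "f \<in> F \<rightarrow> ?Z" "f \<in> (\<Pi> i\<in>F. G i)" using F(2) by (auto simp: ker_grading_def)
      then show "\<forall>i\<in>F. f i = \<zero>\<^bsub>ker_ring A d\<^esub>"
        using fs[OF F(1)] F(1,3) components_direct
        by (simp add: direct_family_def ker_ring_def)
    qed
  qed
qed

end

end

theory Submission
  imports Defs
begin

text \<open>Intersecting with the ring of cycles \<open>ker d\<close> sends a dg-right ideal \<open>I\<close> of \<open>A\<close> to a
  graded right ideal of \<open>ker d\<close>. If \<open>I \<noteq> 0\<close> then \<open>I \<inter> ker d \<noteq> 0\<close>, because \<open>d I \<subseteq> I \<inter> ker d\<close>, so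
  that \<open>I \<inter> ker d = 0\<close> would give \<open>d I = 0\<close>, i.e. \<open>I \<subseteq> ker d\<close>. Hence an infinite direct sum
  of non-zero dg-right ideals of \<open>A\<close> restricts to such a sum of graded right ideals
  of \<open>ker d\<close>.\<close>

lemma (in abelian_monoid) direct_family_image_subsets:
  assumes "direct_family G S (\<lambda>I. I)" and "inj_on h S"
    and "\<And>I. I \<in> S \<Longrightarrow> h I \<subseteq> I" and "\<And>I. I \<in> S \<Longrightarrow> I \<subseteq> carrier G"
  shows "direct_family G (h ` S) (\<lambda>I. I)"
  unfolding direct_family_def
proof (intro allI impI)
  fix F f
  assume F: "finite F" "F \<subseteq> h ` S" "f \<in> (\<Pi> I\<in>F. I)" "finsum G f F = \<zero>"
  obtain E where E: "E \<subseteq> S" "finite E" "F = h ` E"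
    using finite_subset_image[OF F(1,2)] by blast
  have mem: "f (h I) \<in> I" if "I \<in> E" for I
    using that E F(3) assms(3) by blast
  have "finsum G f (h ` E) = finsum G (\<lambda>I. f (h I)) E"
    using mem E(1) assms(4) inj_on_subset[OF assms(2) E(1)]
    by (intro finsum_reindex) blast+
  then have "finsum G (\<lambda>I. f (h I)) E = \<zero>" using F(4) E(3) by simp
  moreover have "(\<lambda>I. f (h I)) \<in> (\<Pi> I\<in>E. I)" using mem by blast
  ultimately have "\<forall>I\<in>E. f (h I) = \<zero>"
    using assms(1) E unfolding direct_family_def by blast
  then show "\<forall>I\<in>F. f I = \<zero>" using E(3) by blast
qed

text \<open>A common element gives the vanishing sum of \<open>x\<close>, taken from
  \<open>I\<close>, and its negative, taken from \<open>J\<close>; directness makes both summands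
  zero. This will separate the traces of distinct ideals on the cycles.\<close>

lemma (in abelian_group) direct_family_inter_trivial:
  assumes "direct_family G S (\<lambda>I. I)" "I \<in> S" "J \<in> S" "I \<noteq> J"
    and "additive_subgroup J G" "x \<in> I" "x \<in> J"
  shows "x = \<zero>"
proof -
  interpret J: additive_subgroup J G by fact
  define f where "f = (\<lambda>K. if K = I then x else \<ominus> x)"
  have x: "x \<in> carrier G" using assms(7) J.a_subset by blast
  then have "finsum G f {I, J} = \<zero>"
    using assms(4) by (simp add: f_def r_neg)
  moreover have "f \<in> (\<Pi> K\<in>{I, J}. K)"
    using assms(6,7) by (auto simp: f_def intro: J.a_inv_closed)
  ultimately have "\<forall>K\<in>{I, J}. f K = \<zero>"
    using assms(1-3) unfolding direct_family_def
    by (metis empty_subsetI finite.emptyI finite.insertI insert_subset)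
  then show ?thesis by (simp add: f_def)
qed

context dg_algebra
begin

interpretation d: abelian_group_hom A A d by (rule d_hom)

text \<open>The addition is that of \<open>A\<close>, but \<open>finsum\<close> also depends on the
  carrier, so sums of cycles have to be transferred explicitly.\<close>

lemma finsum_ker_ring:
  assumes "finite F" "f \<in> F \<rightarrow> a_kernel A A d"
  shows "finsum (ker_ring A d) f F = finsum A f F"
  using finsum_carrier_update[OF abelian_group_axioms d.additive_subgroup_a_kernel _ assms]
    ring.is_abelian_group[OF subring_is_ring[OF kernel_subring]]
  by (simp add: ker_ring_def)

lemma direct_family_ker_ring:
  assumes "direct_family A S N" "\<And>i. i \<in> S \<Longrightarrow> N i \<subseteq> a_kernel A A d"
  shows "direct_family (ker_ring A d) S N"
  unfolding direct_family_def
proof (intro allI impI)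
  fix F f
  assume F: "finite F" "F \<subseteq> S" "f \<in> (\<Pi> i\<in>F. N i)"
    "finsum (ker_ring A d) f F = \<zero>\<^bsub>ker_ring A d\<^esub>"
  have "f \<in> F \<rightarrow> a_kernel A A d" using F(2,3) assms(2) by blast
  then have "finsum A f F = \<zero>"
    using F(4) finsum_ker_ring[OF F(1)] by (simp add: ker_ring_def)
  then show "\<forall>i\<in>F. f i = \<zero>\<^bsub>ker_ring A d\<^esub>"
    using assms(1) F(1-3) by (simp add: direct_family_def ker_ring_def)
qed

lemma right_ideal_inter_kernel:
  assumes "right_ideal A I"
  shows "right_ideal (ker_ring A d) (I \<inter> a_kernel A A d)"
  unfolding right_ideal_def
proof (intro conjI ballI)
  let ?Z = "a_kernel A A d"
  have I: "additive_subgroup I A" using assms by (simp add: right_ideal_def)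
  have Z: "additive_subgroup ?Z A" by (rule d.additive_subgroup_a_kernel)
  have "subgroup (I \<inter> ?Z) (add_monoid A)"
    using I Z add.subgroups_Inter_pair by (simp add: additive_subgroup_def)
  then show "additive_subgroup (I \<inter> ?Z) (ker_ring A d)"
    using add.subgroup_incl[of "I \<inter> ?Z" ?Z] Z by (simp add: additive_subgroup_def ker_ring_def)
  fix x r assume "x \<in> I \<inter> ?Z" "r \<in> carrier (ker_ring A d)"
  then show "x \<otimes>\<^bsub>ker_ring A d\<^esub> r \<in> I \<inter> ?Z"
    using assms by (simp add: right_ideal_def ker_ring_def kernel_iff d_mult_kernel)
qed

text \<open>The homogeneous parts of an element of \<open>I\<close> can be chosen in
  \<open>I\<close>; if the element is a cycle, these parts are cycles too, so the decomposition
  stays inside the intersection.\<close>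

lemma graded_right_ideal_inter_kernel:
  assumes "graded_right_ideal A G I"
  shows "graded_right_ideal (ker_ring A d) (ker_grading A G d) (I \<inter> a_kernel A A d)"
proof -
  let ?Z = "a_kernel A A d"
  let ?N = "\<lambda>i. I \<inter> ?Z \<inter> ker_grading A G d i"
  note I = conjunct1[OF assms[unfolded graded_right_ideal_def]]
    conjunct2[OF assms[unfolded graded_right_ideal_def]]
  have "I \<inter> ?Z \<subseteq> sum_of_family (ker_ring A d) UNIV ?N"
  proof
    fix x assume x: "x \<in> I \<inter> ?Z"
    then have "x \<in> sum_of_family A UNIV (\<lambda>i. I \<inter> G i)"
      using equalityD1[OF I(2)] by blast
    then obtain f F where F: "finite F" "f \<in> (\<Pi> i\<in>F. I \<inter> G i)" "x = finsum A f F"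
      unfolding sum_of_family_def by auto
    have G: "f \<in> (\<Pi> i\<in>F. G i)" using F(2) by blast
    have "f i \<in> ?N i" if "i \<in> F" for i
    proof -
      \<comment> \<open>As \<open>d\<close> raises every degree by one, the elements
        \<open>d (f i)\<close> lie in distinct degrees and sum to \<open>d x = \<zero>\<close>, so
        each of them vanishes.\<close>
      have "d (f i) = \<zero>"
        using homogeneous_parts_in_kernel[OF F(1) G _ that] x F(3) by (simp add: kernel_iff)
      moreover have "f i \<in> I" "f i \<in> G i" using F(2) that by auto
      ultimately show ?thesis
        using component_carrier[of "f i" i] by (simp add: ker_grading_def kernel_iff)
    qed
    then have f: "f \<in> (\<Pi> i\<in>F. ?N i)" by blast
    then have "f \<in> F \<rightarrow> ?Z" by blast
    then have "x = finsum (ker_ring A d) f F"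
      using finsum_ker_ring[OF F(1)] F(3) by simp
    then show "x \<in> sum_of_family (ker_ring A d) UNIV ?N"
      using F(1) f unfolding sum_of_family_def by blast
  qed
  moreover have "sum_of_family (ker_ring A d) UNIV ?N \<subseteq> I \<inter> ?Z"
  proof
    fix x assume "x \<in> sum_of_family (ker_ring A d) UNIV ?N"
    then obtain f F where F: "finite F" "f \<in> (\<Pi> i\<in>F. ?N i)" "x = finsum (ker_ring A d) f F"
      unfolding sum_of_family_def by auto
    have fZ: "f \<in> F \<rightarrow> ?Z" using F(2) by auto
    have x: "x = finsum A f F" using F(3) finsum_ker_ring[OF F(1) fZ] by simp
    have "f \<in> (\<Pi> i\<in>F. I \<inter> G i)" using F(2) by (auto simp: ker_grading_def)
    then have "x \<in> sum_of_family A UNIV (\<lambda>i. I \<inter> G i)"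
      using F(1) x unfolding sum_of_family_def by blast
    \<comment> \<open>Closure of \<open>I\<close> under finite sums is read off from its equality
      with the sum of its homogeneous parts.\<close>
    then have "x \<in> I" using equalityD2[OF I(2)] by blast
    moreover have "x \<in> ?Z"
    proof -
      interpret Z: ring "ker_ring A d"
        unfolding ker_ring_def by (rule subring_is_ring[OF kernel_subring])
      show ?thesis using Z.finsum_closed[of f F] fZ F(3) by (simp add: ker_ring_def)
    qed
    ultimately show "x \<in> I \<inter> ?Z" by blast
  qed
  ultimately show ?thesis
    unfolding graded_right_ideal_def
    using right_ideal_inter_kernel[OF I(1)] by (intro conjI equalityI)
qed

lemma dg_right_ideal_additive_subgroup:
  assumes "dg_right_ideal A G d I"
  shows "additive_subgroup I A"
  using assms unfolding dg_right_ideal_def graded_right_ideal_def right_ideal_def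
  by (rule conjunct1[OF conjunct1[OF conjunct1]])

lemma dg_right_ideal_inter_kernel_nonzero:
  assumes "dg_right_ideal A G d I" "I \<noteq> {\<zero>}"
  shows "I \<inter> a_kernel A A d \<noteq> {\<zero>}"
proof
  assume triv: "I \<inter> a_kernel A A d = {\<zero>}"
  have I: "I \<subseteq> carrier A" "d ` I \<subseteq> I"
    using additive_subgroup.a_subset[OF dg_right_ideal_additive_subgroup[OF assms(1)]] assms(1)
    by (simp_all add: dg_right_ideal_def)
  have "x = \<zero>" if x: "x \<in> I" for x
  proof -
    have "d x \<in> I \<inter> a_kernel A A d" using x I by (auto simp: kernel_iff d_square)
    then have "d x = \<zero>" using triv by blast
    then have "x \<in> I \<inter> a_kernel A A d" using x I(1) by (auto simp: kernel_iff)
    then show ?thesis using triv by blast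
  qed
  \<comment> \<open>Besides forcing all elements to vanish, \<open>triv\<close> puts \<zero> into
    \<open>I\<close>, which excludes the empty set.\<close>
  then show False using assms(2) triv by blast
qed

theorem finite_dg_uniform_dim_if_kernel:
  assumes "finite_gr_uniform_dim (ker_ring A d) (ker_grading A G d)"
  shows "finite_dg_uniform_dim A G d"
  unfolding finite_dg_uniform_dim_def
proof
  let ?h = "\<lambda>I. I \<inter> a_kernel A A d"
  assume "\<exists>S. infinite S \<and> (\<forall>I\<in>S. dg_right_ideal A G d I \<and> I \<noteq> {\<zero>}) \<and>
            direct_family A S (\<lambda>I. I)"
  then obtain S where S: "infinite S" "\<And>I. I \<in> S \<Longrightarrow> dg_right_ideal A G d I"
      "\<And>I. I \<in> S \<Longrightarrow> I \<noteq> {\<zero>}" "direct_family A S (\<lambda>I. I)"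
    by blast
  have sub: "additive_subgroup I A" if "I \<in> S" for I
    by (rule dg_right_ideal_additive_subgroup[OF S(2)[OF that]])
  have nz: "?h I \<noteq> {\<zero>}" if "I \<in> S" for I
    by (rule dg_right_ideal_inter_kernel_nonzero[OF S(2)[OF that] S(3)[OF that]])
  \<comment> \<open>If distinct \<open>I\<close> and \<open>J\<close> had the same cycles, these
    would lie in both ideals and hence be zero by directness, contradicting \<open>nz\<close>.
    Injectivity keeps the image of \<open>S\<close> infinite and allows directness to pass to
    it.\<close>
  have "inj_on ?h S"
  proof (rule inj_onI, rule ccontr)
    fix I J assume IJ: "I \<in> S" "J \<in> S" "?h I = ?h J" "I \<noteq> J"
    have "x = \<zero>" if "x \<in> ?h I" for x
      using direct_family_inter_trivial[OF S(4) IJ(1,2,4) sub[OF IJ(2)]] that IJ(3) by blast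
    moreover have "\<zero> \<in> ?h I"
      using additive_subgroup.zero_closed[OF sub[OF IJ(1)]] by (simp add: kernel_iff)
    ultimately show False using nz[OF IJ(1)] by blast
  qed
  then have "infinite (?h ` S)" and dir: "direct_family A (?h ` S) (\<lambda>I. I)"
    using S(1) finite_imageD
    by (blast, intro direct_family_image_subsets[OF S(4)] additive_subgroup.a_subset sub) auto
  \<comment> \<open>Directness has so far been shown for sums formed in \<open>A\<close>; all
    members consist of cycles, so it also holds in \<open>ker_ring A d\<close>.\<close>
  moreover have "direct_family (ker_ring A d) (?h ` S) (\<lambda>I. I)"
    by (rule direct_family_ker_ring[OF dir]) blast
  moreover have "\<forall>I\<in>?h ` S. graded_right_ideal (ker_ring A d) (ker_grading A G d) I \<and>
      I \<noteq> {\<zero>\<^bsub>ker_ring A d\<^esub>}"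
  proof
    fix J assume "J \<in> ?h ` S"
    then obtain I where I: "I \<in> S" "J = ?h I" by blast
    have "graded_right_ideal A G I" using S(2)[OF I(1)] by (simp add: dg_right_ideal_def)
    from graded_right_ideal_inter_kernel[OF this] nz[OF I(1)] show
      "graded_right_ideal (ker_ring A d) (ker_grading A G d) J \<and> J \<noteq> {\<zero>\<^bsub>ker_ring A d\<^esub>}"
      by (simp add: I(2) ker_ring_def)
  qed
  ultimately show False using assms unfolding finite_gr_uniform_dim_def by blast
qed

end

theorem lemma7p2:
  fixes K :: "('k, 'n) ring_scheme" and A :: "('k, 'a, 'm) module_scheme"
    and G :: "int \<Rightarrow> 'a set" and d :: "'a \<Rightarrow> 'a"
  assumes "dg_algebra K A G d"
    and "finite_gr_uniform_dim (ker_ring A d) (ker_grading A G d)"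
  shows "finite_dg_uniform_dim A G d"
  using assms by (rule dg_algebra.finite_dg_uniform_dim_if_kernel)

end
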